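(* For any $\alpha>0$ there is $C>0$ such that for any $\varepsilon,p,q\in(0,\tfrac12)$ with $q\ge(1+\alpha)p$, writing $r=C\log\varepsilon^{-1}$ and $\delta=10^{-3r-1}\varepsilon^3$, any monotone $(r,\delta)$-global Boolean function $f:\{0,1\}^n\to\{0,1\}$ with $\mu_p(f)\le\delta$ satisfies $\mu_q(f)\ge\mu_p(f)/\varepsilon$.
   Context: $\mu_p$ is the $p$-biased product measure on $\{0,1\}^n$. $f$ is monotone if $f(x)\le f(y)$ whenever $x_i\le y_i$ for all $i$. For $J\subseteq[n]$, $f_{J\to1}$ is the function on $\{0,1\}^{[n]\setminus J}$ obtained by setting the coordinates of $J$ to $1$. $f$ is $(r,\delta)$-global (with respect to $\mu_p$) if $\mu_p(f_{J\to1})\le\mu_p(f)+\delta$ for every $J\subseteq[n]$ with $|J|\le r$. *)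

theory Defs
  imports "HOL-Probability.Probability" "HOL-Probability.Product_PMF"
begin

text \<open>
  The discrete cube \<open>{0,1}\<^sup>I\<close> over a coordinate set \<open>I\<close>: Boolean assignments, normalised to
  \<^const>\<open>False\<close> outside \<open>I\<close>. A Boolean function on this cube is a predicate on
  \<^typ>\<open>nat \<Rightarrow> bool\<close>; all notions below only depend on its values on the relevant cube.
\<close>

definition cube :: "nat set \<Rightarrow> (nat \<Rightarrow> bool) set" where
  "cube I = PiE_dflt I False (\<lambda>_. UNIV)"

definition biased_pmf :: "nat set \<Rightarrow> real \<Rightarrow> (nat \<Rightarrow> bool) pmf" where
  "biased_pmf I p = Pi_pmf I False (\<lambda>_. bernoulli_pmf p)"

definition biased_measure :: "nat set \<Rightarrow> real \<Rightarrow> ((nat \<Rightarrow> bool) \<Rightarrow> bool) \<Rightarrow> real" where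
  "biased_measure I p f = measure_pmf.prob (biased_pmf I p) {x \<in> cube I. f x}"

text \<open>
  For \<open>f\<close> on \<open>{0,1}\<^sup>I\<close> and \<open>J \<subseteq> I\<close>, the following is \<open>f\<^bsub>J\<rightarrow>1\<^esub>\<close>, to be regarded as a function on
  \<open>{0,1}\<close> to the power \<open>I - J\<close>.
\<close>

definition set_to_one :: "nat set \<Rightarrow> ((nat \<Rightarrow> bool) \<Rightarrow> bool) \<Rightarrow> (nat \<Rightarrow> bool) \<Rightarrow> bool" where
  "set_to_one J f = (\<lambda>y. f (\<lambda>i. if i \<in> J then True else y i))"

text \<open>The parameter \<open>r\<close> is real, since it is used with logarithmic values.\<close>

definition is_global :: "nat set \<Rightarrow> real \<Rightarrow> real \<Rightarrow> real \<Rightarrow> ((nat \<Rightarrow> bool) \<Rightarrow> bool) \<Rightarrow> bool" where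
  "is_global I p r \<delta> f \<longleftrightarrow>
     (\<forall>J\<subseteq>I. real (card J) \<le> r \<longrightarrow>
        biased_measure (I - J) p (set_to_one J f) \<le> biased_measure I p f + \<delta>)"

end

theory Submission
  imports Defs
begin

text \<open>
  Couple \<open>x \<le> y\<close> with \<open>x\<close> distributed by \<open>\<mu>\<^sub>p\<close> and \<open>y\<close> by \<open>\<mu>\<^sub>q\<close>, and let \<open>Tf(y)\<close> be the conditional
  expectation of \<open>f(x)\<close>. By monotonicity \<open>\<mu>\<^sub>p(f)\<close> is the \<open>\<mu>\<^sub>q\<close>-expectation of \<open>f \<cdot> Tf\<close>, so by
  Cauchy-Schwarz its square is at most \<open>\<mu>\<^sub>q(f)\<close> times the second moment of \<open>Tf\<close>. In the
  \<open>p\<close>-biased Fourier expansion that second moment is the noise stability of \<open>f\<close> with parameter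
  \<open>\<rho> = p(1 - q) / (q(1 - p)) \<le> 1 / (1 + \<alpha>)\<close>. Levels above \<open>r\<close> are killed by \<open>\<rho>\<^sup>r\<close>.
  The weight of levels up to \<open>r\<close> is small by a level inequality: the fourth moment of the
  low-degree part of \<open>f\<close> is controlled by the influences of sets \<open>S\<close> of size at most \<open>r\<close>, and
  those are at most \<open>4\<^bsup>|S|\<^esup> \<mu>\<^sub>p(f\<^bsub>S\<rightarrow>1\<^esub>)\<close>.
\<close>

text \<open>Points of the cube are identified with the subsets of \<open>I\<close>.\<close>

definition bexp :: "real \<Rightarrow> 'a set \<Rightarrow> ('a set \<Rightarrow> real) \<Rightarrow> real" where
  "bexp p I f = (\<Sum>X\<in>Pow I. p ^ card X * (1 - p) ^ card (I - X) * f X)"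

text \<open>
  The characters are left unnormalised: they are the products of \<open>x\<^sub>i - p\<close> over \<open>i \<in> T\<close>, of second
  moment \<open>(p(1 - p))\<close> to the power \<open>|T|\<close>. The coefficient at \<open>T\<close> is then the expected discrete
  derivative of \<open>f\<close> in the directions \<open>T\<close>, and no square roots occur.
\<close>

definition coef :: "real \<Rightarrow> 'a set \<Rightarrow> ('a set \<Rightarrow> real) \<Rightarrow> 'a set \<Rightarrow> real" where
  "coef p I f T = bexp p I (\<lambda>X. f X * (\<Prod>i\<in>T. if i \<in> X then 1 / p else - 1 / (1 - p)))"

text \<open>For finite \<open>I\<close>, \<open>0 < p < 1\<close> and \<open>c = coef p I f\<close>
  this is the Fourier expansion of \<open>f\<close>; zeroing values of \<open>c\<close> truncates
  it.\<close>

definition biased_poly :: "real \<Rightarrow> 'a set \<Rightarrow> ('a set \<Rightarrow> real) \<Rightarrow> 'a set \<Rightarrow> real" where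
  "biased_poly p I c X = (\<Sum>T\<in>Pow I. c T * (\<Prod>i\<in>T. of_bool (i \<in> X) - p))"

text \<open>For \<open>c = coef p I f\<close> and \<open>w = p * (1 - p)\<close> this is
  \<open>w ^ card S\<close> times the second moment of the discrete derivative of \<open>f\<close>
  in the directions \<open>S\<close>: the influence of \<open>S\<close> up to normalisation.\<close>

definition up_weight :: "real \<Rightarrow> 'a set \<Rightarrow> ('a set \<Rightarrow> real) \<Rightarrow> 'a set \<Rightarrow> real" where
  "up_weight w I c S = (\<Sum>T\<in>Pow I. of_bool (S \<subseteq> T) * w ^ card T * (c T)\<^sup>2)"

section \<open>Biased expectation over subsets\<close>

lemma sum_Pow_insert:
  assumes "finite I" "i \<notin> I"
  shows "(\<Sum>X\<in>Pow (insert i I). F X) = (\<Sum>X\<in>Pow I. F X) + (\<Sum>X\<in>Pow I. F (insert i X))"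
proof -
  have "(\<Sum>X\<in>Pow (insert i I). F X) = sum F (Pow I) + sum F (insert i ` Pow I)"
    unfolding Pow_insert using assms by (intro sum.union_disjoint) auto
  moreover have "inj_on (insert i) (Pow I)"
    using assms by (auto simp: inj_on_def)
  ultimately show ?thesis by (simp add: sum.reindex)
qed

lemma bexp_empty [simp]: "bexp p {} f = f {}"
  by (simp add: bexp_def)

lemma bexp_cong: "(\<And>X. X \<subseteq> I \<Longrightarrow> f X = g X) \<Longrightarrow> bexp p I f = bexp p I g"
  by (auto simp: bexp_def intro!: sum.cong)

lemma bexp_insert:
  assumes "finite I" "i \<notin> I"
  shows "bexp p (insert i I) f = (1 - p) * bexp p I f + p * bexp p I (\<lambda>X. f (insert i X))"
proof -
  have "card (insert i I - X) = Suc (card (I - X))" if "X \<subseteq> I" for X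
  proof -
    have "insert i I - X = insert i (I - X)" using that assms by auto
    then show ?thesis using assms by simp
  qed
  moreover have "card (insert i X) = Suc (card X)" if "X \<subseteq> I" for X
    using that assms finite_subset[of X I] by (auto simp: card_insert_if)
  moreover have "insert i I - insert i X = I - X" if "X \<subseteq> I" for X
    using that assms by auto
  ultimately show ?thesis
    unfolding bexp_def sum_Pow_insert[OF assms] sum_distrib_left
    by (intro arg_cong2[of _ _ _ _ "(+)"] sum.cong) auto
qed

lemma bexp_add: "bexp p I (\<lambda>X. f X + g X) = bexp p I f + bexp p I g"
  by (simp add: bexp_def algebra_simps sum.distrib)

lemma bexp_diff: "bexp p I (\<lambda>X. f X - g X) = bexp p I f - bexp p I g"
  by (simp add: bexp_def algebra_simps sum_subtractf)

lemma bexp_cmult: "bexp p I (\<lambda>X. a * f X) = a * bexp p I f"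
  by (simp add: bexp_def algebra_simps sum_distrib_left)

lemma bexp_sum: "bexp p I (\<lambda>X. \<Sum>t\<in>A. f t X) = (\<Sum>t\<in>A. bexp p I (f t))"
  unfolding bexp_def sum_distrib_left by (rule sum.swap)

lemma bexp_mono:
  assumes "0 \<le> p" "p \<le> 1" "\<And>X. X \<subseteq> I \<Longrightarrow> f X \<le> g X"
  shows "bexp p I f \<le> bexp p I g"
  unfolding bexp_def using assms by (intro sum_mono mult_left_mono) auto

lemma bexp_nonneg:
  assumes "0 \<le> p" "p \<le> 1" "\<And>X. X \<subseteq> I \<Longrightarrow> 0 \<le> f X"
  shows "0 \<le> bexp p I f"
  unfolding bexp_def using assms by (intro sum_nonneg mult_nonneg_nonneg) auto

lemma bexp_one: "finite I \<Longrightarrow> bexp 1 I f = f I"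
proof (induction I arbitrary: f rule: finite_induct)
  case (insert i I)
  then show ?case by (simp add: bexp_insert)
qed simp

lemma bexp_Cauchy_Schwarz:
  assumes "0 \<le> p" "p \<le> 1"
  shows "(bexp p I (\<lambda>X. f X * g X))\<^sup>2 \<le> bexp p I (\<lambda>X. (f X)\<^sup>2) * bexp p I (\<lambda>X. (g X)\<^sup>2)"
proof -
  define w where "w X = p ^ card X * (1 - p) ^ card (I - X)" for X
  have w: "w X \<ge> 0" for X unfolding w_def using assms by simp
  have "(\<Sum>X\<in>Pow I. (sqrt (w X) * f X) * (sqrt (w X) * g X))\<^sup>2
      \<le> (\<Sum>X\<in>Pow I. (sqrt (w X) * f X)\<^sup>2) * (\<Sum>X\<in>Pow I. (sqrt (w X) * g X)\<^sup>2)"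
    by (rule Cauchy_Schwarz_ineq_sum)
  moreover have "(sqrt (w X) * f X) * (sqrt (w X) * g X) = w X * (f X * g X)" for X
    using real_sqrt_mult_self[of "w X"] w[of X] by (simp add: algebra_simps)
  ultimately show ?thesis
    using w by (simp add: bexp_def w_def[symmetric] power_mult_distrib)
qed

text \<open>Keeping each element of a \<open>q\<close>-random \<open>Y\<close> with probability
  \<open>p / q\<close> yields a \<open>p\<close>-random set. This is the coupling, and
  \<open>bexp (p / q) Y f\<close> is \<open>Tf(Y)\<close>.\<close>

lemma bexp_bexp:
  assumes "finite I" "q \<noteq> 0"
  shows "bexp q I (\<lambda>Y. bexp (p / q) Y f) = bexp p I f"
  using assms(1)
proof (induction I arbitrary: f rule: finite_induct)
  case (insert i I)
  have "bexp q I (\<lambda>Y. bexp (p / q) (insert i Y) f) =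
        bexp q I (\<lambda>Y. (1 - p / q) * bexp (p / q) Y f + p / q * bexp (p / q) Y (\<lambda>X. f (insert i X)))"
    using insert.hyps by (intro bexp_cong bexp_insert) (auto intro: finite_subset)
  also have "\<dots> = (1 - p / q) * bexp p I f + p / q * bexp p I (\<lambda>X. f (insert i X))"
    by (simp only: bexp_add bexp_cmult insert.IH)
  finally show ?case
    unfolding bexp_insert[OF insert.hyps] insert.IH using assms by (simp add: field_simps)
qed simp

section \<open>Fourier coefficients and noise stability\<close>

lemma coef_insert_notin:
  assumes "finite I" "i \<notin> I" "T \<subseteq> I"
  shows "coef p (insert i I) f T = coef p I (\<lambda>X. (1 - p) * f X + p * f (insert i X)) T"
proof -
  have "(\<Prod>j\<in>T. if j \<in> insert i X then 1 / p else - 1 / (1 - p)) =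
        (\<Prod>j\<in>T. if j \<in> X then 1 / p else - 1 / (1 - p))" for X
    using assms by (intro prod.cong) auto
  then show ?thesis
    unfolding coef_def bexp_insert[OF assms(1,2)] bexp_cmult[symmetric] bexp_add[symmetric]
    by (intro bexp_cong) (simp add: algebra_simps)
qed

text \<open>The weights \<open>1 / p\<close> and \<open>- 1 / (1 - p)\<close> at \<open>i\<close>
  cancel the probabilities of its two values and leave a difference. Coefficients without
  \<open>i\<close> see the average over that coordinate instead, so both kinds reduce to
  coefficients on \<open>I\<close>.\<close>

lemma coef_insert_in:
  assumes "finite I" "i \<notin> I" "T \<subseteq> I" "0 < p" "p < 1"
  shows "coef p (insert i I) f (insert i T) = coef p I (\<lambda>X. f (insert i X) - f X) T"
proof -
  have fin: "finite T" "i \<notin> T" using assms finite_subset by auto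
  have "(\<Prod>j\<in>T. if j \<in> insert i X then 1 / p else - 1 / (1 - p)) =
        (\<Prod>j\<in>T. if j \<in> X then 1 / p else - 1 / (1 - p))" for X
    using assms by (intro prod.cong) auto
  then show ?thesis
    unfolding coef_def bexp_insert[OF assms(1,2)] bexp_cmult[symmetric] bexp_add[symmetric]
    using assms(2,4,5) fin
    by (intro bexp_cong) (auto simp: field_simps)
qed

text \<open>Given \<open>y\<close>, the factor \<open>x_i - p\<close> has expectation
  \<open>(p / q) * (y_i - q)\<close>, whose second moment under \<open>q\<close> is
  \<open>p\<^sup>2 * (1 - q) / q\<close>. So \<open>T\<close> is diagonal on characters; the
  induction verifies this one coordinate at a time.\<close>

lemma noise_formula:
  assumes "finite I" "0 < p" "p < 1" "0 < q"
  shows "bexp q I (\<lambda>Y. (bexp (p / q) Y f)\<^sup>2) =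
         (\<Sum>T\<in>Pow I. (p\<^sup>2 * (1 - q) / q) ^ card T * (coef p I f T)\<^sup>2)"
  using assms(1)
proof (induction I arbitrary: f rule: finite_induct)
  case empty
  then show ?case by (simp add: coef_def)
next
  case (insert i I)
  define f1 where "f1 = (\<lambda>X. f (insert i X))"
  define a where "a = p\<^sup>2 * (1 - q) / q"
  let ?m = "\<lambda>X. (1 - p) * f X + p * f1 X" and ?D = "\<lambda>X. f1 X - f X"
  have card: "card (insert i T) = Suc (card T)" if "T \<subseteq> I" for T
    using that insert.hyps finite_subset[of T I] by (auto simp: card_insert_if)
  \<comment> \<open>Here \<open>x\<close> and \<open>y\<close> stand for
    \<open>bexp (p / q) Y\<close> of \<open>f\<close> and of \<open>f1\<close>. If \<open>i\<close>
    is not in \<open>Y\<close> the smaller set omits it too; otherwise it contains \<open>i\<close>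
    with probability \<open>p / q\<close>. The second moment splits into a mean part and a
    derivative part.\<close>
  have quad: "(1 - q) * x\<^sup>2 + q * ((1 - p / q) * x + p / q * y)\<^sup>2 =
        ((1 - p) * x + p * y)\<^sup>2 + a * (y - x)\<^sup>2" for x y
    unfolding a_def using assms(4) by (simp add: field_simps power2_eq_square)
  have ins: "bexp q I (\<lambda>Y. (bexp (p / q) (insert i Y) f)\<^sup>2) =
      bexp q I (\<lambda>Y. ((1 - p / q) * bexp (p / q) Y f + p / q * bexp (p / q) Y f1)\<^sup>2)"
  proof (intro bexp_cong)
    fix Y assume "Y \<subseteq> I"
    then have Y: "finite Y" "i \<notin> Y" using insert.hyps by (auto intro: finite_subset)
    show "(bexp (p / q) (insert i Y) f)\<^sup>2 =
        ((1 - p / q) * bexp (p / q) Y f + p / q * bexp (p / q) Y f1)\<^sup>2"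
      unfolding f1_def bexp_insert[OF Y] ..
  qed
  have "bexp q (insert i I) (\<lambda>Y. (bexp (p / q) Y f)\<^sup>2) =
      bexp q I (\<lambda>Y. (1 - q) * (bexp (p / q) Y f)\<^sup>2
         + q * ((1 - p / q) * bexp (p / q) Y f + p / q * bexp (p / q) Y f1)\<^sup>2)"
    by (simp only: bexp_insert[OF insert.hyps] ins bexp_add[of q I] bexp_cmult[of q I])
  also have "\<dots> = bexp q I (\<lambda>Y. (bexp (p / q) Y ?m)\<^sup>2) + a * bexp q I (\<lambda>Y. (bexp (p / q) Y ?D)\<^sup>2)"
    by (simp only: quad bexp_add bexp_cmult bexp_diff)
  also have "\<dots> = (\<Sum>T\<in>Pow I. a ^ card T * (coef p I ?m T)\<^sup>2)
      + (\<Sum>T\<in>Pow I. a ^ Suc (card T) * (coef p I ?D T)\<^sup>2)"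
    unfolding insert.IH a_def[symmetric] by (simp add: sum_distrib_left mult.assoc)
  also have "\<dots> = (\<Sum>T\<in>Pow (insert i I). a ^ card T * (coef p (insert i I) f T)\<^sup>2)"
    unfolding sum_Pow_insert[OF insert.hyps] f1_def
    using insert.hyps assms
    by (intro arg_cong2[of _ _ _ _ "(+)"] sum.cong)
       (auto simp: coef_insert_notin coef_insert_in card)
  finally show ?case unfolding a_def .
qed

text \<open>The case \<open>q = p\<close>, where the noise is trivial.\<close>

lemma Parseval:
  assumes "finite I" "0 < p" "p < 1"
  shows "(\<Sum>T\<in>Pow I. (p * (1 - p)) ^ card T * (coef p I f T)\<^sup>2) = bexp p I (\<lambda>X. (f X)\<^sup>2)"
proof -
  have "bexp p I (\<lambda>Y. (bexp (p / p) Y f)\<^sup>2) = bexp p I (\<lambda>X. (f X)\<^sup>2)"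
    using assms by (intro bexp_cong) (auto simp: bexp_one finite_subset)
  moreover have "p\<^sup>2 * (1 - p) / p = p * (1 - p)"
    using assms by (simp add: power2_eq_square)
  ultimately show ?thesis using noise_formula[of I p p f] assms by simp
qed

text \<open>Plancherel: \<open>x_i - p\<close> is \<open>p * (1 - p)\<close> times the weight that
  \<open>coef\<close> attaches to \<open>i\<close>.\<close>

lemma bexp_mult_biased_poly:
  fixes f :: "'a set \<Rightarrow> real"
  assumes "0 < p" "p < 1"
  shows "bexp p I (\<lambda>X. f X * biased_poly p I c X) =
         (\<Sum>T\<in>Pow I. c T * (p * (1 - p)) ^ card T * coef p I f T)"
proof -
  have "(\<Prod>i\<in>T. of_bool (i \<in> X) - p) =
        (p * (1 - p)) ^ card T * (\<Prod>i\<in>T. if i \<in> X then 1 / p else - 1 / (1 - p))" for T X :: "'a set"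
    unfolding prod_constant[symmetric] prod.distrib[symmetric]
    using assms by (intro prod.cong) auto
  then have eq: "f X * (c T * (\<Prod>i\<in>T. of_bool (i \<in> X) - p)) = c T * (p * (1 - p)) ^ card T *
      (f X * (\<Prod>i\<in>T. if i \<in> X then 1 / p else - 1 / (1 - p)))" for T X
    by simp
  show ?thesis
    unfolding biased_poly_def sum_distrib_left bexp_sum coef_def bexp_cmult[symmetric] eq ..
qed

section \<open>Hypercontractivity\<close>

text \<open>The polynomial is affine in \<open>x_i - p\<close>, which takes the values
  \<open>- p\<close> and \<open>1 - p\<close>.\<close>

lemma biased_poly_insert:
  assumes "finite I" "i \<notin> I" "X \<subseteq> I"
  shows "biased_poly p (insert i I) c X =
           biased_poly p I c X - p * biased_poly p I (\<lambda>T. c (insert i T)) X"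
    and "biased_poly p (insert i I) c (insert i X) =
           biased_poly p I c X + (1 - p) * biased_poly p I (\<lambda>T. c (insert i T)) X"
proof -
  have eq: "(\<Prod>j\<in>insert i T. of_bool (j \<in> Y) - p) = (of_bool (i \<in> Y) - p) * (\<Prod>j\<in>T. of_bool (j \<in> Y) - p)"
    if "T \<subseteq> I" for T Y
    using that assms finite_subset[of T I] by (subst prod.insert) auto
  have eq2: "(\<Prod>j\<in>T. of_bool (j \<in> insert i X) - p) = (\<Prod>j\<in>T. of_bool (j \<in> X) - p)"
    if "T \<subseteq> I" for T
    using that assms by (intro prod.cong) auto
  have "i \<notin> X" using assms by auto
  show "biased_poly p (insert i I) c X =
           biased_poly p I c X - p * biased_poly p I (\<lambda>T. c (insert i T)) X"
    unfolding biased_poly_def sum_Pow_insert[OF assms(1,2)] diff_conv_add_uminus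
      sum_distrib_left sum_negf[symmetric]
    using \<open>i \<notin> X\<close> by (intro arg_cong2[of _ _ _ _ "(+)"] sum.cong) (auto simp: eq)
  show "biased_poly p (insert i I) c (insert i X) =
           biased_poly p I c X + (1 - p) * biased_poly p I (\<lambda>T. c (insert i T)) X"
    unfolding biased_poly_def sum_Pow_insert[OF assms(1,2)] sum_distrib_left
    by (intro arg_cong2[of _ _ _ _ "(+)"] sum.cong) (auto simp: eq eq2 simp del: insert_iff)
qed

lemma up_weight_insert:
  assumes "finite I" "i \<notin> I" "S \<subseteq> I"
  shows "up_weight w (insert i I) c S =
           up_weight w I c S + w * up_weight w I (\<lambda>T. c (insert i T)) S"
    and "up_weight w (insert i I) c (insert i S) = w * up_weight w I (\<lambda>T. c (insert i T)) S"
proof -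
  have card: "card (insert i T) = Suc (card T)" if "T \<subseteq> I" for T
    using that assms finite_subset[of T I] by (auto simp: card_insert_if)
  have "i \<notin> S" using assms by auto
  show "up_weight w (insert i I) c S =
           up_weight w I c S + w * up_weight w I (\<lambda>T. c (insert i T)) S"
    unfolding up_weight_def sum_Pow_insert[OF assms(1,2)] sum_distrib_left
    using \<open>i \<notin> S\<close>
    by (intro arg_cong2[of _ _ _ _ "(+)"] sum.cong) (auto simp: card subset_insert)
  have "(\<Sum>T\<in>Pow I. of_bool (insert i S \<subseteq> T) * w ^ card T * (c T)\<^sup>2) = 0"
    using assms by (intro sum.neutral) auto
  moreover have "insert i S \<subseteq> insert i T \<longleftrightarrow> S \<subseteq> T" for T
    using \<open>i \<notin> S\<close> by auto
  ultimately show "up_weight w (insert i I) c (insert i S) = w * up_weight w I (\<lambda>T. c (insert i T)) S"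
    unfolding up_weight_def sum_Pow_insert[OF assms(1,2)] sum_distrib_left
    by (simp add: card mult_ac)
qed

lemma up_weight_nonneg: "0 \<le> w \<Longrightarrow> 0 \<le> up_weight w I c S"
  unfolding up_weight_def by (intro sum_nonneg) auto

text \<open>The induction step of the fourth moment bound in a single coordinate. The last constant
  is kept as \<open>4 * v * (4 * v) / v\<close> to match two weights \<open>4 * v\<close> and one
  factor \<open>1 / v\<close> for a set \<open>S\<close> containing that coordinate.\<close>

lemma two_point_inequality:
  fixes p a b c d :: real
  assumes "0 < p" "p < 1"
  defines "v \<equiv> p * (1 - p)"
  shows "(1 - p) * ((a - p * b)\<^sup>2 * (c - p * d)\<^sup>2) + p * ((a + (1 - p) * b)\<^sup>2 * (c + (1 - p) * d)\<^sup>2)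
       \<le> a\<^sup>2 * c\<^sup>2 + 4 * v * (a\<^sup>2 * d\<^sup>2) + 4 * v * (b\<^sup>2 * c\<^sup>2) + 4 * v * (4 * v) / v * (b\<^sup>2 * d\<^sup>2)"
proof -
  have v: "v > 0" unfolding v_def using assms by simp
  \<comment> \<open>The centred bit has moments 0, \<open>v\<close>, \<open>v * (1 - 2 * p)\<close>
    and \<open>v * (1 - 3 * v)\<close>. The mixed terms are then removed by the arithmetic-geometric
    mean inequality.\<close>
  have m: "(1 - p) * ((a - p * b)\<^sup>2 * (c - p * d)\<^sup>2) + p * ((a + (1 - p) * b)\<^sup>2 * (c + (1 - p) * d)\<^sup>2)
     = a\<^sup>2 * c\<^sup>2 + v * (a\<^sup>2 * d\<^sup>2 + b\<^sup>2 * c\<^sup>2 + 4 * (a * d) * (b * c)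
         + 2 * ((1 - 2 * p) * (b * d)) * (a * d) + 2 * ((1 - 2 * p) * (b * d)) * (b * c)
         + (1 - 3 * v) * (b * d)\<^sup>2)"
    unfolding v_def by algebra
  have 1: "4 * (a * d) * (b * c) \<le> 2 * (a\<^sup>2 * d\<^sup>2) + 2 * (b\<^sup>2 * c\<^sup>2)"
    using sum_squares_bound[of "a * d" "b * c"] by (simp add: power_mult_distrib)
  have "((1 - 2 * p) * (b * d))\<^sup>2 \<le> 1 * (b * d)\<^sup>2"
    unfolding power_mult_distrib[of "1 - 2 * p"] using assms
    by (intro mult_right_mono) (auto simp: abs_square_le_1)
  then have 2: "2 * ((1 - 2 * p) * (b * d)) * (a * d) \<le> b\<^sup>2 * d\<^sup>2 + a\<^sup>2 * d\<^sup>2"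
    and 3: "2 * ((1 - 2 * p) * (b * d)) * (b * c) \<le> b\<^sup>2 * d\<^sup>2 + b\<^sup>2 * c\<^sup>2"
    using sum_squares_bound[of "(1 - 2 * p) * (b * d)" "a * d"]
      sum_squares_bound[of "(1 - 2 * p) * (b * d)" "b * c"] by (simp_all add: power_mult_distrib)
  have 4: "(1 - 3 * v) * (b * d)\<^sup>2 \<le> 1 * (b\<^sup>2 * d\<^sup>2)"
    unfolding power_mult_distrib using v by (intro mult_right_mono) auto
  have "0 \<le> b\<^sup>2 * d\<^sup>2" by simp
  then have "a\<^sup>2 * d\<^sup>2 + b\<^sup>2 * c\<^sup>2 + 4 * (a * d) * (b * c)
         + 2 * ((1 - 2 * p) * (b * d)) * (a * d) + 2 * ((1 - 2 * p) * (b * d)) * (b * c)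
         + (1 - 3 * v) * (b * d)\<^sup>2 \<le> 4 * (a\<^sup>2 * d\<^sup>2) + 4 * (b\<^sup>2 * c\<^sup>2) + 16 * (b\<^sup>2 * d\<^sup>2)"
    using 1 2 3 4 by linarith
  from mult_left_mono[OF this, of v] v show ?thesis
    unfolding m by (simp add: algebra_simps)
qed

text \<open>
  The bilinear form of the statement is what makes the induction on \<open>I\<close> close: with \<open>c = e\<close> one
  would have to bound mixed terms that the induction hypothesis does not mention.
\<close>

lemma hypercontractivity:
  assumes "finite I" "0 < p" "p < 1"
  defines "v \<equiv> p * (1 - p)"
  shows "bexp p I (\<lambda>X. (biased_poly p I c X)\<^sup>2 * (biased_poly p I e X)\<^sup>2)
       \<le> (\<Sum>S\<in>Pow I. (1 / v) ^ card S * (up_weight (4 * v) I c S * up_weight (4 * v) I e S))"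
  using assms(1)
proof (induction I arbitrary: c e rule: finite_induct)
  case empty
  then show ?case by (simp add: biased_poly_def up_weight_def)
next
  case (insert i I)
  have v: "v > 0" unfolding v_def using assms by simp
  define c1 where "c1 = (\<lambda>T. c (insert i T))"
  define e1 where "e1 = (\<lambda>T. e (insert i T))"
  let ?P = "biased_poly p I" and ?W = "up_weight (4 * v) I"
  let ?E = "\<lambda>c e. bexp p I (\<lambda>X. (?P c X)\<^sup>2 * (?P e X)\<^sup>2)"
  let ?N = "\<lambda>c e. \<Sum>S\<in>Pow I. (1 / v) ^ card S * (?W c S * ?W e S)"
  have card: "card (insert i T) = Suc (card T)" if "T \<subseteq> I" for T
    using that insert.hyps finite_subset[of T I] by (auto simp: card_insert_if)
  have "bexp p (insert i I) (\<lambda>X. (biased_poly p (insert i I) c X)\<^sup>2 * (biased_poly p (insert i I) e X)\<^sup>2)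
      = bexp p I (\<lambda>X. (1 - p) * ((?P c X - p * ?P c1 X)\<^sup>2 * (?P e X - p * ?P e1 X)\<^sup>2)
          + p * ((?P c X + (1 - p) * ?P c1 X)\<^sup>2 * (?P e X + (1 - p) * ?P e1 X)\<^sup>2))"
    unfolding bexp_insert[OF insert.hyps] bexp_cmult[symmetric] bexp_add[symmetric] c1_def e1_def
    using insert.hyps by (intro bexp_cong) (simp add: biased_poly_insert)
  also have "\<dots> \<le> bexp p I (\<lambda>X. (?P c X)\<^sup>2 * (?P e X)\<^sup>2 + 4 * v * ((?P c X)\<^sup>2 * (?P e1 X)\<^sup>2)
      + 4 * v * ((?P c1 X)\<^sup>2 * (?P e X)\<^sup>2) + 4 * v * (4 * v) / v * ((?P c1 X)\<^sup>2 * (?P e1 X)\<^sup>2))"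
    unfolding v_def using assms by (intro bexp_mono two_point_inequality) auto
  also have "\<dots> = ?E c e + 4 * v * ?E c e1 + 4 * v * ?E c1 e + 4 * v * (4 * v) / v * ?E c1 e1"
    by (simp only: bexp_add bexp_cmult)
  also have "\<dots> \<le> ?N c e + 4 * v * ?N c e1 + 4 * v * ?N c1 e + 4 * v * (4 * v) / v * ?N c1 e1"
    using v by (intro add_mono mult_left_mono insert.IH) auto
  also have "\<dots> \<le> (\<Sum>S\<in>Pow (insert i I). (1 / v) ^ card S *
      (up_weight (4 * v) (insert i I) c S * up_weight (4 * v) (insert i I) e S))"
    unfolding sum_Pow_insert[OF insert.hyps] sum_distrib_left sum.distrib[symmetric]
  proof (intro sum_mono)
    fix S assume S: "S \<in> Pow I"
    \<comment> \<open>The set \<open>S\<close> absorbs the first three terms and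
      \<open>insert i S\<close> equals the fourth; the surplus \<open>zw\<close> term of the
      expanded product is nonnegative.\<close>
    have key: "k * (x * y) + 4 * v * (k * (x * w)) + 4 * v * (k * (z * y))
          + 4 * v * (4 * v) / v * (k * (z * w))
        \<le> k * ((x + 4 * v * z) * (y + 4 * v * w)) + 1 / v * k * (4 * v * z * (4 * v * w))"
      if "0 \<le> k" "0 \<le> z" "0 \<le> w" for k x y z w
    proof -
      have "0 \<le> k * (4 * v * z * (4 * v * w))" using that v by simp
      then show ?thesis using v by (simp add: algebra_simps)
    qed
    show "(1 / v) ^ card S * (?W c S * ?W e S) + 4 * v * ((1 / v) ^ card S * (?W c S * ?W e1 S))
        + 4 * v * ((1 / v) ^ card S * (?W c1 S * ?W e S))
        + 4 * v * (4 * v) / v * ((1 / v) ^ card S * (?W c1 S * ?W e1 S))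
      \<le> (1 / v) ^ card S * (up_weight (4 * v) (insert i I) c S * up_weight (4 * v) (insert i I) e S)
        + (1 / v) ^ card (insert i S) *
          (up_weight (4 * v) (insert i I) c (insert i S) * up_weight (4 * v) (insert i I) e (insert i S))"
      using key[of "(1 / v) ^ card S" "?W c1 S" "?W e1 S" "?W c S" "?W e S"] S v insert.hyps
      by (simp add: up_weight_insert card c1_def e1_def up_weight_nonneg)
  qed
  finally show ?case .
qed

section \<open>Level inequality\<close>

text \<open>The derivative in the directions \<open>S\<close> is a signed sum of
  \<open>2 ^ card S\<close> values of \<open>f\<close>, each bounded by \<open>g\<close>; squaring
  gives the power of 4. Each induction step differentiates once and doubles
  \<open>g\<close>.\<close>

lemma up_weight_coef_le:
  assumes "finite S" "finite I" "S \<inter> I = {}" "0 < p" "p < 1"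
    and "\<And>X A. X \<subseteq> I \<Longrightarrow> A \<subseteq> S \<Longrightarrow> \<bar>f (X \<union> A)\<bar> \<le> g X"
  defines "v \<equiv> p * (1 - p)"
  shows "up_weight v (I \<union> S) (coef p (I \<union> S) f) S \<le> (4 * v) ^ card S * bexp p I (\<lambda>X. (g X)\<^sup>2)"
  using assms(1,3,6)
proof (induction S arbitrary: f g rule: finite_induct)
  case empty
  have "up_weight v I (coef p I f) {} = bexp p I (\<lambda>X. (f X)\<^sup>2)"
    unfolding up_weight_def v_def using Parseval[of I p f] assms by simp
  also have "\<dots> \<le> bexp p I (\<lambda>X. (g X)\<^sup>2)"
  proof (rule bexp_mono)
    fix X assume "X \<subseteq> I"
    then have "\<bar>f X\<bar> \<le> g X" using empty.prems(2)[of X "{}"] by simp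
    then show "(f X)\<^sup>2 \<le> (g X)\<^sup>2"
      using power_mono[of "\<bar>f X\<bar>" "g X" 2] by simp
  qed (use assms in auto)
  finally show ?case by simp
next
  case (insert i S)
  have v: "v > 0" unfolding v_def using assms by simp
  have i: "finite (I \<union> S)" "i \<notin> I \<union> S" using insert assms by auto
  let ?D = "\<lambda>X. f (insert i X) - f X"
  have "up_weight v (insert i (I \<union> S)) (coef p (insert i (I \<union> S)) f) (insert i S)
      = v * up_weight v (I \<union> S) (\<lambda>T. coef p (insert i (I \<union> S)) f (insert i T)) S"
    by (intro up_weight_insert i) auto
  also have "up_weight v (I \<union> S) (\<lambda>T. coef p (insert i (I \<union> S)) f (insert i T)) S
      = up_weight v (I \<union> S) (coef p (I \<union> S) ?D) S"
    unfolding up_weight_def by (intro sum.cong) (auto simp: coef_insert_in[OF i] assms)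
  also have "v * up_weight v (I \<union> S) (coef p (I \<union> S) ?D) S
      \<le> v * ((4 * v) ^ card S * bexp p I (\<lambda>X. (2 * g X)\<^sup>2))"
  proof (intro mult_left_mono insert.IH)
    fix X A assume XA: "X \<subseteq> I" "A \<subseteq> S"
    have "\<bar>f (X \<union> insert i A)\<bar> \<le> g X" "\<bar>f (X \<union> A)\<bar> \<le> g X"
      using XA insert.prems(2)[of X "insert i A"] insert.prems(2)[of X A] by auto
    then show "\<bar>f (insert i (X \<union> A)) - f (X \<union> A)\<bar> \<le> 2 * g X" by simp
  qed (use insert.prems v in auto)
  also have "\<dots> = (4 * v) ^ card (insert i S) * bexp p I (\<lambda>X. (g X)\<^sup>2)"
    using insert.hyps by (simp add: power_mult_distrib bexp_cmult)
  finally show ?case by simp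
qed

text \<open>With \<open>h\<close> the part of \<open>f\<close> of degree at most \<open>d\<close>,
  \<open>M\<close> is the expectation of \<open>f * h\<close>. Two Cauchy-Schwarz steps bound
  \<open>M ^ 4\<close> by \<open>\<mu> ^ 3\<close> times the fourth moment of \<open>h\<close>,
  which is at most \<open>128 ^ d * \<kappa> * M\<close>; one factor \<open>M\<close>
  cancels.\<close>

lemma level_inequality:
  fixes f :: "'a set \<Rightarrow> real"
  assumes I: "finite I" and p: "0 < p" "p < 1"
    and f01: "\<And>X. X \<subseteq> I \<Longrightarrow> f X = 0 \<or> f X = 1"
    and mono: "\<And>X Y. X \<subseteq> Y \<Longrightarrow> Y \<subseteq> I \<Longrightarrow> f X \<le> f Y"
    and glob: "\<And>S. S \<subseteq> I \<Longrightarrow> card S \<le> d \<Longrightarrow> bexp p (I - S) (\<lambda>X. f (X \<union> S)) \<le> \<kappa>"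
    and \<kappa>: "0 \<le> \<kappa>"
  defines "M \<equiv> \<Sum>T\<in>{T. T \<subseteq> I \<and> card T \<le> d}. (p * (1 - p)) ^ card T * (coef p I f T)\<^sup>2"
  shows "M ^ 3 \<le> (bexp p I f) ^ 3 * (\<kappa> * 128 ^ d)"
proof -
  define v where "v = p * (1 - p)"
  have v: "v > 0" unfolding v_def using p by simp
  define c where "c T = of_bool (card T \<le> d) * coef p I f T" for T
  define h where "h = biased_poly p I c"
  define \<mu> where "\<mu> = bexp p I f"
  have c2: "(c T)\<^sup>2 = of_bool (card T \<le> d) * (coef p I f T)\<^sup>2" for T
    unfolding c_def by simp
  have M: "M = (\<Sum>T\<in>Pow I. v ^ card T * (c T)\<^sup>2)"
    unfolding M_def v_def c2 by (intro sum.mono_neutral_cong_left) (use I in auto)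
  have M0: "M \<ge> 0" unfolding M using v by (intro sum_nonneg) auto
  have sq: "(f X)\<^sup>2 = f X" "f X \<ge> 0" if "X \<subseteq> I" for X
    using f01[OF that] by auto
  have \<mu>0: "\<mu> \<ge> 0" unfolding \<mu>_def using p sq by (intro bexp_nonneg) auto
  have W4: "up_weight (4 * v) I c S \<le> 4 ^ d * up_weight v I c S" for S
    unfolding up_weight_def sum_distrib_left
  proof (intro sum_mono)
    fix T
    have "(4::real) ^ card T * (v ^ card T * (c T)\<^sup>2) \<le> 4 ^ d * (v ^ card T * (c T)\<^sup>2)"
    proof (cases "card T \<le> d")
      case True
      then show ?thesis using v by (intro mult_right_mono power_increasing) auto
    qed (simp add: c_def)
    then show "of_bool (S \<subseteq> T) * (4 * v) ^ card T * (c T)\<^sup>2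
        \<le> 4 ^ d * (of_bool (S \<subseteq> T) * v ^ card T * (c T)\<^sup>2)"
      by (simp add: power_mult_distrib mult_ac)
  qed
  \<comment> \<open>One \<open>4 ^ d\<close> comes from the influence bound, two from replacing the
    weight \<open>4 * v\<close> by \<open>v\<close>. For \<open>card S > d\<close> both sides
    vanish.\<close>
  have level_term: "(1 / v) ^ card S * (up_weight (4 * v) I c S * up_weight (4 * v) I c S)
      \<le> 64 ^ d * \<kappa> * up_weight v I c S" if S: "S \<subseteq> I" for S
  proof (cases "card S \<le> d")
    case True
    have fS: "finite S" using S I finite_subset by auto
    have IS: "I - S \<union> S = I" using S by auto
    have "up_weight v I c S \<le> up_weight v I (coef p I f) S"
      unfolding up_weight_def c2 using v by (intro sum_mono) auto
    also have "\<dots> \<le> (4 * v) ^ card S * bexp p (I - S) (\<lambda>X. (f (X \<union> S))\<^sup>2)"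
    proof (rule up_weight_coef_le[of S "I - S" p f "\<lambda>X. f (X \<union> S)", unfolded IS v_def[symmetric]])
      \<comment> \<open>Monotonicity lets the restriction to ones dominate all other restrictions of
        the coordinates in \<open>S\<close>, so globalness controls the influence.\<close>
      fix X A assume XA: "X \<subseteq> I - S" "A \<subseteq> S"
      then have "f (X \<union> A) \<le> f (X \<union> S)" "X \<union> A \<subseteq> I" using S by (auto intro!: mono)
      then show "\<bar>f (X \<union> A)\<bar> \<le> f (X \<union> S)" using sq(2) by simp
    qed (use fS I p in auto)
    also have "bexp p (I - S) (\<lambda>X. (f (X \<union> S))\<^sup>2) = bexp p (I - S) (\<lambda>X. f (X \<union> S))"
      using S by (intro bexp_cong sq) auto
    also have "(4 * v) ^ card S * \<dots> \<le> (4 * v) ^ card S * \<kappa>"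
      using v True S by (intro mult_left_mono glob) auto
    also have "\<dots> = v ^ card S * (4 ^ card S * \<kappa>)"
      by (simp add: power_mult_distrib)
    also have "\<dots> \<le> v ^ card S * (4 ^ d * \<kappa>)"
      using v \<kappa> True by (intro mult_left_mono mult_right_mono power_increasing) auto
    finally have V: "(1 / v) ^ card S * up_weight v I c S \<le> 4 ^ d * \<kappa>"
      using v by (simp add: field_simps)
    have nn: "0 \<le> up_weight v I c S" "0 \<le> up_weight (4 * v) I c S"
      using v by (auto intro: up_weight_nonneg)
    have "(1 / v) ^ card S * (up_weight (4 * v) I c S * up_weight (4 * v) I c S)
        \<le> (1 / v) ^ card S * ((4 ^ d * up_weight v I c S) * (4 ^ d * up_weight v I c S))"
      using v nn W4 by (intro mult_left_mono mult_mono) auto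
    also have "\<dots> = ((1 / v) ^ card S * up_weight v I c S) * (4 ^ d * 4 ^ d * up_weight v I c S)"
      by (simp add: mult_ac)
    also have "\<dots> \<le> (4 ^ d * \<kappa>) * (4 ^ d * 4 ^ d * up_weight v I c S)"
      using nn V by (intro mult_right_mono) auto
    also have "\<dots> = (4 * 4 * 4) ^ d * \<kappa> * up_weight v I c S"
      unfolding power_mult_distrib by (simp add: mult_ac)
    finally show ?thesis by simp
  next
    case False
    have z: "up_weight w I c S = 0" for w
      unfolding up_weight_def
    proof (intro sum.neutral ballI)
      fix T assume "T \<in> Pow I"
      then have "S \<subseteq> T \<Longrightarrow> card S \<le> card T" using I by (auto intro: card_mono finite_subset)
      then show "of_bool (S \<subseteq> T) * w ^ card T * (c T)\<^sup>2 = 0"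
        using False by (auto simp: c_def)
    qed
    show ?thesis by (simp add: z)
  qed
  \<comment> \<open>Double counting: each \<open>T\<close> lies above \<open>2 ^ card T\<close> sets
    \<open>S\<close>, and only \<open>card T \<le> d\<close> matters. This turns 64 into
    128.\<close>
  have "(\<Sum>S\<in>Pow I. up_weight v I c S)
      = (\<Sum>T\<in>Pow I. (\<Sum>S\<in>Pow I. of_bool (S \<subseteq> T)) * (v ^ card T * (c T)\<^sup>2))"
    unfolding up_weight_def sum_distrib_right by (subst sum.swap) (simp add: mult_ac)
  also have "\<dots> \<le> (\<Sum>T\<in>Pow I. 2 ^ d * (v ^ card T * (c T)\<^sup>2))"
  proof (intro sum_mono)
    fix T assume T: "T \<in> Pow I"
    have "(\<Sum>S\<in>Pow I. of_bool (S \<subseteq> T) :: real) = (\<Sum>S\<in>Pow T. 1)"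
      using T I by (intro sum.mono_neutral_cong_right) auto
    also have "\<dots> = 2 ^ card T"
      using T I by (auto simp: card_Pow finite_subset)
    finally have *: "(\<Sum>S\<in>Pow I. of_bool (S \<subseteq> T) :: real) = 2 ^ card T" .
    show "(\<Sum>S\<in>Pow I. of_bool (S \<subseteq> T)) * (v ^ card T * (c T)\<^sup>2) \<le> 2 ^ d * (v ^ card T * (c T)\<^sup>2)"
    proof (cases "card T \<le> d")
      case True
      then show ?thesis unfolding * using v by (intro mult_right_mono power_increasing) auto
    qed (simp add: c_def)
  qed
  also have "\<dots> = 2 ^ d * M" by (simp add: M sum_distrib_left)
  finally have sumW: "(\<Sum>S\<in>Pow I. up_weight v I c S) \<le> 2 ^ d * M" .
  have "bexp p I (\<lambda>X. ((h X)\<^sup>2)\<^sup>2)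
      \<le> (\<Sum>S\<in>Pow I. (1 / v) ^ card S * (up_weight (4 * v) I c S * up_weight (4 * v) I c S))"
    using hypercontractivity[OF I p, of c c]
    by (simp add: h_def v_def power2_eq_square mult.assoc)
  also have "\<dots> \<le> (\<Sum>S\<in>Pow I. 64 ^ d * \<kappa> * up_weight v I c S)"
    using level_term by (intro sum_mono) auto
  also have "\<dots> \<le> 64 ^ d * \<kappa> * (2 ^ d * M)"
    unfolding sum_distrib_left[symmetric] using sumW \<kappa> by (intro mult_left_mono) auto
  also have "\<dots> = (64 * 2) ^ d * \<kappa> * M"
    unfolding power_mult_distrib by (simp add: mult_ac)
  finally have h4: "bexp p I (\<lambda>X. ((h X)\<^sup>2)\<^sup>2) \<le> 128 ^ d * \<kappa> * M" by simp
  have fh: "bexp p I (\<lambda>X. f X * h X) = M"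
    unfolding h_def bexp_mult_biased_poly[OF p] M v_def
    by (intro sum.cong) (simp_all add: c_def power2_eq_square)
  have f2: "bexp p I (\<lambda>X. (f X)\<^sup>2) = \<mu>"
    unfolding \<mu>_def by (intro bexp_cong sq)
  have fh2: "bexp p I (\<lambda>X. (f X * h X)\<^sup>2) = bexp p I (\<lambda>X. f X * (h X)\<^sup>2)"
    by (intro bexp_cong) (simp add: power_mult_distrib sq)
  \<comment> \<open>Since \<open>f\<close> is idempotent, an extra factor \<open>f\<close> can be
    inserted, which makes each Cauchy-Schwarz step gain a factor \<open>\<mu>\<close>.\<close>
  have "M = bexp p I (\<lambda>X. f X * (f X * h X))"
    unfolding fh[symmetric] by (intro bexp_cong) (simp add: sq flip: mult.assoc power2_eq_square)
  then have A: "M\<^sup>2 \<le> \<mu> * bexp p I (\<lambda>X. f X * (h X)\<^sup>2)"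
    using bexp_Cauchy_Schwarz[of p I f "\<lambda>X. f X * h X"] p by (simp add: f2 fh2)
  have B: "(bexp p I (\<lambda>X. f X * (h X)\<^sup>2))\<^sup>2 \<le> \<mu> * (128 ^ d * \<kappa> * M)"
    using bexp_Cauchy_Schwarz[of p I f "\<lambda>X. (h X)\<^sup>2"] p mult_left_mono[OF h4 \<mu>0] by (simp add: f2)
  have "M ^ 3 * M = (M\<^sup>2)\<^sup>2" by (simp add: power_numeral_reduce)
  also have "\<dots> \<le> (\<mu> * bexp p I (\<lambda>X. f X * (h X)\<^sup>2))\<^sup>2"
    using A by (intro power_mono) auto
  also have "\<dots> \<le> \<mu>\<^sup>2 * (\<mu> * (128 ^ d * \<kappa> * M))"
    unfolding power_mult_distrib using B by (intro mult_left_mono) auto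
  also have "\<dots> = \<mu> ^ 3 * (\<kappa> * 128 ^ d) * M" by (simp add: power_numeral_reduce)
  finally have *: "M ^ 3 * M \<le> \<mu> ^ 3 * (\<kappa> * 128 ^ d) * M" .
  show ?thesis
  proof (cases "M = 0")
    case True
    then show ?thesis using \<mu>0 \<kappa> unfolding \<mu>_def by simp
  next
    case False
    then show ?thesis using * M0 unfolding \<mu>_def by simp
  qed
qed

section \<open>Sharp threshold for subset functions\<close>

text \<open>The condition on \<open>\<kappa>\<close> makes the levels up to \<open>d\<close>
  contribute at most \<open>\<epsilon> / 2 * \<mu>\<close> to the noise stability; the condition on
  \<open>(p / q) ^ Suc d\<close> does the same for the levels from \<open>d + 1\<close> on.\<close>

lemma sharp_threshold_bexp:
  fixes f :: "'a set \<Rightarrow> real"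
  assumes I: "finite I" and p: "0 < p" "p < q" "q < 1"
    and f01: "\<And>X. X \<subseteq> I \<Longrightarrow> f X = 0 \<or> f X = 1"
    and mono: "\<And>X Y. X \<subseteq> Y \<Longrightarrow> Y \<subseteq> I \<Longrightarrow> f X \<le> f Y"
    and glob: "\<And>S. S \<subseteq> I \<Longrightarrow> card S \<le> d \<Longrightarrow> bexp p (I - S) (\<lambda>X. f (X \<union> S)) \<le> \<kappa>"
    and \<epsilon>: "0 < \<epsilon>" and \<kappa>: "0 \<le> \<kappa>" "\<kappa> * 128 ^ d \<le> (\<epsilon> / 2) ^ 3"
    and d: "(p / q) ^ Suc d \<le> \<epsilon> / 2"
  shows "bexp p I f / \<epsilon> \<le> bexp q I f"
proof -
  define v where "v = p * (1 - p)"
  define M where "M = (\<Sum>T\<in>{T. T \<subseteq> I \<and> card T \<le> d}. v ^ card T * (coef p I f T)\<^sup>2)"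
  define \<mu> where "\<mu> = bexp p I f"
  have v: "v > 0" unfolding v_def using p by simp
  have sq: "(f X)\<^sup>2 = f X" "f X \<ge> 0" if "X \<subseteq> I" for X
    using f01[OF that] by auto
  have \<mu>0: "\<mu> \<ge> 0" unfolding \<mu>_def using p sq by (intro bexp_nonneg) auto
  have \<mu>q0: "bexp q I f \<ge> 0" using p sq by (intro bexp_nonneg) auto
  have "M ^ 3 \<le> \<mu> ^ 3 * (\<kappa> * 128 ^ d)"
    unfolding M_def \<mu>_def v_def by (rule level_inequality) (use assms in auto)
  also have "\<dots> \<le> \<mu> ^ 3 * (\<epsilon> / 2) ^ 3"
    using \<mu>0 \<kappa> by (intro mult_left_mono) auto
  finally have "M ^ 3 \<le> (\<mu> * (\<epsilon> / 2)) ^ 3" by (simp add: power_mult_distrib power_divide)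
  then have M: "M \<le> \<mu> * (\<epsilon> / 2)"
    by (rule power_le_imp_le_base[of _ 2, simplified]) (use \<mu>0 \<epsilon> in auto)
  define \<rho> where "\<rho> = p * (1 - q) / (q * (1 - p))"
  have \<rho>: "0 \<le> \<rho>" "\<rho> \<le> p / q" "\<rho> \<le> 1"
  proof -
    show 0: "0 \<le> \<rho>" unfolding \<rho>_def using p by simp
    have "\<rho> = p / q * ((1 - q) / (1 - p))" unfolding \<rho>_def by simp
    also have "\<dots> \<le> p / q * 1" using p by (intro mult_left_mono) auto
    finally show 1: "\<rho> \<le> p / q" by simp
    show "\<rho> \<le> 1" using order_trans[OF 1, of 1] p by simp
  qed
  have \<rho>v: "p\<^sup>2 * (1 - q) / q = \<rho> * v"
    unfolding \<rho>_def v_def using p by (simp add: power2_eq_square)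
  let ?t = "\<lambda>T. v ^ card T * (coef p I f T)\<^sup>2"
  have t0: "0 \<le> ?t T" for T using v by simp
  have "bexp q I (\<lambda>Y. (bexp (p / q) Y f)\<^sup>2) = (\<Sum>T\<in>Pow I. \<rho> ^ card T * ?t T)"
    using noise_formula[of I p q f] I p by (simp add: \<rho>v power_mult_distrib mult.assoc)
  also have "\<dots> \<le> (\<Sum>T\<in>Pow I. of_bool (card T \<le> d) * ?t T + \<epsilon> / 2 * ?t T)"
  proof (intro sum_mono)
    fix T
    show "\<rho> ^ card T * ?t T \<le> of_bool (card T \<le> d) * ?t T + \<epsilon> / 2 * ?t T"
    proof (cases "card T \<le> d")
      case True
      have "\<rho> ^ card T * ?t T \<le> 1 * ?t T"
        using \<rho> t0 by (intro mult_right_mono power_le_one) auto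
      moreover have "0 \<le> \<epsilon> / 2 * ?t T" using t0 \<epsilon> by simp
      ultimately show ?thesis using True by simp
    next
      case False
      have "\<rho> ^ card T \<le> \<rho> ^ Suc d" using False \<rho> by (intro power_decreasing) auto
      also have "\<dots> \<le> (p / q) ^ Suc d" using \<rho> by (intro power_mono) auto
      also have "\<dots> \<le> \<epsilon> / 2" by (rule d)
      finally have "\<rho> ^ card T \<le> \<epsilon> / 2" .
      then have "\<rho> ^ card T * ?t T \<le> \<epsilon> / 2 * ?t T" using t0 by (intro mult_right_mono)
      then show ?thesis using False by simp
    qed
  qed
  also have "\<dots> = M + \<epsilon> / 2 * \<mu>"
  proof -
    have "(\<Sum>T\<in>Pow I. of_bool (card T \<le> d) * ?t T) = M"
      unfolding M_def by (intro sum.mono_neutral_cong_right) (use I in auto)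
    moreover have "(\<Sum>T\<in>Pow I. ?t T) = \<mu>"
      unfolding v_def \<mu>_def using Parseval[of I p f] I p sq
      by (auto intro: bexp_cong)
    ultimately show ?thesis by (simp only: sum.distrib sum_distrib_left[symmetric])
  qed
  also have "\<dots> \<le> \<epsilon> * \<mu>" using M by (simp add: mult.commute)
  finally have stab: "bexp q I (\<lambda>Y. (bexp (p / q) Y f)\<^sup>2) \<le> \<epsilon> * \<mu>" .
  have "\<mu> = bexp q I (\<lambda>Y. bexp (p / q) Y f)"
    unfolding \<mu>_def using I p by (subst bexp_bexp) auto
  also have "\<dots> = bexp q I (\<lambda>Y. f Y * bexp (p / q) Y f)"
  proof (intro bexp_cong)
    fix Y assume Y: "Y \<subseteq> I"
    \<comment> \<open>By monotonicity \<open>f Y = 0\<close> forces \<open>f X = 0\<close>, so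
      \<open>Tf\<close> vanishes wherever \<open>f\<close> does.\<close>
    have "f Y * f X = f X" if "X \<subseteq> Y" for X
      using mono[OF that Y] f01[OF Y] f01[of X] that Y by auto
    then show "bexp (p / q) Y f = f Y * bexp (p / q) Y f"
      unfolding bexp_cmult[symmetric] by (intro bexp_cong) simp
  qed
  finally have "\<mu>\<^sup>2 \<le> bexp q I (\<lambda>X. (f X)\<^sup>2) * bexp q I (\<lambda>Y. (bexp (p / q) Y f)\<^sup>2)"
    using bexp_Cauchy_Schwarz[of q I f] p by simp
  also have "bexp q I (\<lambda>X. (f X)\<^sup>2) = bexp q I f" by (intro bexp_cong sq)
  also have "bexp q I f * bexp q I (\<lambda>Y. (bexp (p / q) Y f)\<^sup>2) \<le> bexp q I f * (\<epsilon> * \<mu>)"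
    using stab \<mu>q0 by (rule mult_left_mono)
  finally have "\<mu> * \<mu> \<le> (bexp q I f * \<epsilon>) * \<mu>" by (simp add: power2_eq_square mult_ac)
  then have "\<mu> \<le> bexp q I f * \<epsilon>"
    using \<mu>0 \<mu>q0 \<epsilon> by (cases "\<mu> = 0") auto
  then show ?thesis using \<epsilon> by (simp add: \<mu>_def field_simps)
qed

section \<open>Transfer to the product measure\<close>

text \<open>The default value \<open>False\<close> outside \<open>I\<close> makes points of the cube
  correspond bijectively to subsets of \<open>I\<close>.\<close>

lemma biased_measure_eq_bexp:
  assumes "finite I" "0 \<le> p" "p \<le> 1"
  shows "biased_measure I p f = bexp p I (\<lambda>X. of_bool (f (\<lambda>i. i \<in> X)))"
proof -
  have cube: "x \<in> cube I \<longleftrightarrow> {i. x i} \<subseteq> I" for x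
    by (auto simp: cube_def PiE_dflt_def)
  have fin: "finite (cube I)"
    unfolding cube_def using assms by (intro finite_PiE_dflt) auto
  have pm: "pmf (biased_pmf I p) (\<lambda>i. i \<in> X) = p ^ card X * (1 - p) ^ card (I - X)"
    if X: "X \<subseteq> I" for X
  proof -
    have "pmf (biased_pmf I p) (\<lambda>i. i \<in> X) = (\<Prod>i\<in>I. pmf (bernoulli_pmf p) (i \<in> X))"
      unfolding biased_pmf_def using assms X by (subst pmf_Pi) auto
    also have "\<dots> = (\<Prod>i\<in>I. if i \<in> X then p else 1 - p)"
      using assms by (intro prod.cong) auto
    also have "\<dots> = (\<Prod>i\<in>X. if i \<in> X then p else 1 - p) * (\<Prod>i\<in>I - X. if i \<in> X then p else 1 - p)"
      using X assms by (subst prod.subset_diff[OF X]) auto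
    also have "\<dots> = p ^ card X * (1 - p) ^ card (I - X)" by simp
    finally show ?thesis .
  qed
  have "biased_measure I p f = (\<Sum>x\<in>{x \<in> cube I. f x}. pmf (biased_pmf I p) x)"
    unfolding biased_measure_def using fin by (intro measure_measure_pmf_finite) auto
  also have "\<dots> = (\<Sum>x\<in>cube I. pmf (biased_pmf I p) x * of_bool (f x))"
    using fin by (intro sum.mono_neutral_cong_left) auto
  also have "\<dots> = bexp p I (\<lambda>X. of_bool (f (\<lambda>i. i \<in> X)))"
    unfolding bexp_def
    by (rule sum.reindex_bij_witness[where i = "\<lambda>X i. i \<in> X" and j = "\<lambda>x. {i. x i}"])
       (auto simp: cube pm[symmetric] subset_iff)
  finally show ?thesis .
qed

theorem theorem3p3:
  fixes \<alpha> :: real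
  assumes "\<alpha> > 0"
  shows "\<exists>C::real. C > 0 \<and>
    (\<forall>\<epsilon>\<in>{0<..<1/2}. \<forall>p\<in>{0<..<1/2}. \<forall>q\<in>{0<..<1/2}. q \<ge> (1 + \<alpha>) * p \<longrightarrow>
      (let r = C * ln (1 / \<epsilon>); \<delta> = 10 powr (- 3 * r - 1) * \<epsilon> ^ 3 in
        \<forall>(n::nat) (f :: (nat \<Rightarrow> bool) \<Rightarrow> bool).
          mono_on (cube {1..n}) f \<longrightarrow>
          is_global {1..n} p r \<delta> f \<longrightarrow>
          biased_measure {1..n} p f \<le> \<delta> \<longrightarrow>
          biased_measure {1..n} q f \<ge> biased_measure {1..n} p f / \<epsilon>))"
proof -
  \<comment> \<open>The first term gives \<open>(1 + \<alpha>) powr r \<ge> 1 / \<epsilon>\<^sup>2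
    \<ge> 2 / \<epsilon>\<close>, which handles the high levels; the second ensures
    \<open>r \<ge> 1\<close>.\<close>
  define C where "C = 2 / ln (1 + \<alpha>) + 2"
  have l\<alpha>: "ln (1 + \<alpha>) > 0" using assms by simp
  have "C > 0" unfolding C_def using l\<alpha> by (simp add: add_pos_pos)
  moreover have "biased_measure {1..n} p f / \<epsilon> \<le> biased_measure {1..n} q f"
    if \<epsilon>: "\<epsilon> \<in> {0<..<1/2}" and p: "p \<in> {0<..<1/2}" and q: "q \<in> {0<..<1/2}"
      and pq: "(1 + \<alpha>) * p \<le> q" and r: "r = C * ln (1 / \<epsilon>)"
      and \<delta>: "\<delta> = 10 powr (- 3 * r - 1) * \<epsilon> ^ 3"
      and mono: "mono_on (cube {1..n}) f" and glob: "is_global {1..n} p r \<delta> f"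
      and small: "biased_measure {1..n} p f \<le> \<delta>"
    for \<epsilon> p q r \<delta> :: real and n and f :: "(nat \<Rightarrow> bool) \<Rightarrow> bool"
  proof -
    define I where "I = {1..n}"
    define g :: "nat set \<Rightarrow> real" where "g = (\<lambda>X. of_bool (f (\<lambda>i. i \<in> X)))"
    \<comment> \<open>Rounding down keeps sets of size \<open>d\<close> within reach of globalness,
      while \<open>Suc d\<close> is still at least \<open>r\<close>.\<close>
    define d where "d = nat \<lfloor>r\<rfloor>"
    define L where "L = ln (1 / \<epsilon>)"
    have "ln 2 \<le> L" unfolding L_def using \<epsilon> by (subst ln_le_cancel_iff) (auto simp: field_simps)
    then have L: "L \<ge> 1 / 2" "L \<ge> ln 2" using ln2_ge_two_thirds by auto
    have rL: "r = 2 / ln (1 + \<alpha>) * L + 2 * L" unfolding r C_def L_def by (simp add: algebra_simps)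
    have "0 \<le> 2 / ln (1 + \<alpha>) * L" using l\<alpha> L by simp
    then have r1: "r \<ge> 1" using L rL by linarith
    have d: "real d \<le> r" "r \<le> real (Suc d)" unfolding d_def using r1 by linarith+
    have "p < q" using pq p mult_pos_pos[OF assms, of p] by (simp add: distrib_right)
    have fin: "finite I" by (simp add: I_def)
    have bm: "biased_measure J s F = bexp s J (\<lambda>X. of_bool (F (\<lambda>i. i \<in> X)))"
      if "s \<in> {0<..<1/2}" "J \<subseteq> I" for s J F
      using that fin by (intro biased_measure_eq_bexp) (auto intro: finite_subset)
    have \<delta>0: "\<delta> > 0" unfolding \<delta> using \<epsilon> by simp
    have "bexp p I g / \<epsilon> \<le> bexp q I g"
    \<comment> \<open>One \<open>\<delta>\<close> bounds the measure of \<open>f\<close>, the other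
      is the increase that globalness allows.\<close>
    proof (rule sharp_threshold_bexp[where d = d and \<kappa> = "2 * \<delta>"])
      fix X Y assume "X \<subseteq> Y" "Y \<subseteq> I"
      then have "f (\<lambda>i. i \<in> X) \<le> f (\<lambda>i. i \<in> Y)"
        by (intro mono_onD[OF mono]) (auto simp: cube_def PiE_dflt_def I_def le_fun_def)
      then show "g X \<le> g Y" by (simp add: g_def)
    next
      fix S assume S: "S \<subseteq> I" "card S \<le> d"
      then have "biased_measure (I - S) p (set_to_one S f) \<le> biased_measure I p f + \<delta>"
        using glob[unfolded is_global_def, rule_format, of S] d(1) by (simp add: I_def)
      also have "\<dots> \<le> 2 * \<delta>" using small by (simp add: I_def)
      also have "biased_measure (I - S) p (set_to_one S f) = bexp p (I - S) (\<lambda>X. g (X \<union> S))"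
      proof -
        have "(\<lambda>i. i \<in> X \<union> S) = (\<lambda>i. if i \<in> S then True else i \<in> X)" for X
          by auto
        then show ?thesis using p by (subst bm) (auto simp: g_def set_to_one_def)
      qed
      finally show "bexp p (I - S) (\<lambda>X. g (X \<union> S)) \<le> 2 * \<delta>" .
    next
      \<comment> \<open>The goal amounts to \<open>16 * 128 ^ d \<le> 10 powr (3 * r + 1)\<close>.
        As \<open>128 * 7 = 896 \<le> 1000\<close>, a spare \<open>7 powr r \<ge> 7\<close> remains,
        and \<open>16 \<le> 10 * 7\<close>.\<close>
      have "16 * 128 ^ d \<le> 10 * (128 powr r * 7 powr r)"
      proof -
        have "128 ^ d = 128 powr real d" by (simp add: powr_realpow)
        also have "\<dots> \<le> 128 powr r" using d by (intro powr_mono) auto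
        finally have "(128::real) ^ d \<le> 128 powr r" .
        moreover have "(7::real) powr 1 \<le> 7 powr r" using r1 by (intro powr_mono) auto
        then have "128 powr r * 7 \<le> 128 powr r * 7 powr r" by (intro mult_left_mono) auto
        moreover have "0 \<le> (128::real) powr r" by simp
        ultimately show ?thesis by linarith
      qed
      also have "128 powr r * 7 powr r = (896::real) powr r"
        by (subst powr_mult[symmetric]) auto
      also have "\<dots> \<le> 1000 powr r" using r1 by (intro powr_mono2) auto
      also have "\<dots> = 10 powr (3 * r)"
        using powr_powr[of 10 3 r] by simp
      finally have "16 * 128 ^ d \<le> 10 * 10 powr (3 * r)" by simp
      then have "16 * 128 ^ d * 10 powr (- 3 * r - 1) \<le> 10 * 10 powr (3 * r) * 10 powr (- 3 * r - 1)"
        by (rule mult_right_mono) simp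
      also have "10 * 10 powr (3 * r) * 10 powr (- 3 * r - 1) = (1 :: real)"
        by (simp add: powr_diff powr_minus)
      finally have "16 * 128 ^ d * 10 powr (- 3 * r - 1) \<le> (1 :: real)" .
      from mult_right_mono[OF this, of "\<epsilon> ^ 3"] \<epsilon>
      show "2 * \<delta> * 128 ^ d \<le> (\<epsilon> / 2) ^ 3"
        unfolding \<delta> by (simp add: power_divide mult_ac)
    next
      \<comment> \<open>Of the two copies of \<open>L\<close>, one yields
        \<open>1 / \<epsilon>\<close> and the other covers \<open>ln 2\<close>, because
        \<open>\<epsilon> < 1 / 2\<close>.\<close>
      have "2 * L \<le> r * ln (1 + \<alpha>)"
        unfolding rL using l\<alpha> L by (simp add: field_simps)
      also have "\<dots> \<le> real (Suc d) * ln (1 + \<alpha>)"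
        using d l\<alpha> by (intro mult_right_mono) auto
      finally have "2 * L \<le> ln ((1 + \<alpha>) ^ Suc d)"
        using assms by (subst ln_realpow) auto
      moreover have "ln (2 / \<epsilon>) = ln 2 + L" unfolding L_def using \<epsilon> by (simp add: ln_div)
      ultimately have "ln (2 / \<epsilon>) \<le> ln ((1 + \<alpha>) ^ Suc d)" using L by linarith
      then have *: "2 / \<epsilon> \<le> (1 + \<alpha>) ^ Suc d"
        using \<epsilon> assms by (subst (asm) ln_le_cancel_iff) auto
      have "(p / q) ^ Suc d \<le> (1 / (1 + \<alpha>)) ^ Suc d"
        using p q pq assms by (intro power_mono) (auto simp: field_simps)
      also have "\<dots> = 1 / (1 + \<alpha>) ^ Suc d" by (simp add: power_divide)
      also have "\<dots> \<le> 1 / (2 / \<epsilon>)"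
        using * \<epsilon> assms by (intro divide_left_mono) auto
      finally show "(p / q) ^ Suc d \<le> \<epsilon> / 2" by simp
    qed (use fin p q \<epsilon> \<open>p < q\<close> \<delta>0 in \<open>auto simp: g_def\<close>)
    then show ?thesis
      unfolding g_def I_def[symmetric] bm[OF p order_refl] bm[OF q order_refl] .
  qed
  ultimately show ?thesis
    by (intro exI[of _ C]) (auto simp: Let_def)
qed

end
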